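(* Let $\mathbb{K}$ be an algebraically closed field with $\operatorname{char}(\mathbb{K})\neq 2$ and let $G$ be a connected non-bipartite simple graph on $[n]$. Then $$\mathrm{v}_{\mathfrak{p}^{+}(G)}(\mathcal{I}_G)=\gamma_n(G)=\min\{|S| : S\subseteq[n]\text{ is a dominating set of } G\text{ and } G[S]\text{ is totally non-bipartite}\}.$$
   Context: $[n]=\{1,\dots,n\}$ and $R=\mathbb{K}[x_1,\dots,x_n,y_1,\dots,y_n]$ with the standard grading. The parity binomial edge ideal is $\mathcal{I}_G=(x_ix_j-y_iy_j:\{i,j\}\in E(G))\subseteq R$, and $\mathfrak{p}^{+}(G)=(x_i+y_i: i\in[n])$, which under the given hypotheses is a minimal prime of $\mathcal{I}_G$. $S\subseteq[n]$ is a dominating set of $G$ if every vertex of $[n]\setminus S$ is adjacent to some vertex of $S$. $G[S]$ is the induced subgraph on $S$. A graph is totally non-bipartite if all its connected components are non-bipartite. For a graded ideal $I\subset R$ and $\mathfrak p\in\mathrm{Ass}(I)$, $\mathrm{v}_{\mathfrak p}(I)=\min\{d\ge 0:\exists f\in R_d \text{ with } I:f=\mathfrak p\}$. *)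

theory Defs
  imports
    "HOL-Library.Poly_Mapping"
    "HOL-Computational_Algebra.Computational_Algebra"
begin

text \<open>
  The vertex set $[n]$ is the universe of a finite type \<open>'n\<close>, so that $n$ is \<open>CARD('n)\<close>.
  A graph is given by its adjacency relation. The polynomial ring
  $R = K[x_1,\dots,x_n,y_1,\dots,y_n]$ is the monoid algebra over \<open>'k\<close> of the monomials in the
  variables \<open>Inl i\<close> (for $x_i$) and \<open>Inr i\<close> (for $y_i$).
\<close>

subsection \<open>Graphs\<close>

definition simple_graph :: "('n \<Rightarrow> 'n \<Rightarrow> bool) \<Rightarrow> bool" where
  "simple_graph G \<longleftrightarrow> symp G \<and> irreflp G"

definition induced :: "('n \<Rightarrow> 'n \<Rightarrow> bool) \<Rightarrow> 'n set \<Rightarrow> 'n \<Rightarrow> 'n \<Rightarrow> bool" where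
  "induced G S u v \<longleftrightarrow> u \<in> S \<and> v \<in> S \<and> G u v"

definition connected_graph :: "('n \<Rightarrow> 'n \<Rightarrow> bool) \<Rightarrow> bool" where
  "connected_graph G \<longleftrightarrow> (\<forall>u v. G\<^sup>*\<^sup>* u v)"

definition bipartite :: "('n \<Rightarrow> 'n \<Rightarrow> bool) \<Rightarrow> bool" where
  "bipartite G \<longleftrightarrow> (\<exists>A. \<forall>u v. G u v \<longrightarrow> (u \<in> A \<longleftrightarrow> v \<notin> A))"

text \<open>Vertex sets of the connected components of the induced subgraph $G[S]$.\<close>

definition induced_components :: "('n \<Rightarrow> 'n \<Rightarrow> bool) \<Rightarrow> 'n set \<Rightarrow> 'n set set" where
  "induced_components G S = {{v. (induced G S)\<^sup>*\<^sup>* u v} | u. u \<in> S}"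

definition totally_non_bipartite :: "('n \<Rightarrow> 'n \<Rightarrow> bool) \<Rightarrow> 'n set \<Rightarrow> bool" where
  "totally_non_bipartite G S \<longleftrightarrow>
     (\<forall>C \<in> induced_components G S. \<not> bipartite (induced G C))"

definition dominating :: "('n \<Rightarrow> 'n \<Rightarrow> bool) \<Rightarrow> 'n set \<Rightarrow> bool" where
  "dominating G S \<longleftrightarrow> (\<forall>v. v \<notin> S \<longrightarrow> (\<exists>u\<in>S. G v u))"

text \<open>For connected non-bipartite \<open>G\<close> the set is nonempty, since \<open>S = UNIV\<close> qualifies.\<close>

definition gamma_n :: "('n::finite \<Rightarrow> 'n \<Rightarrow> bool) \<Rightarrow> nat" where
  "gamma_n G = Min {card S | S. dominating G S \<and> totally_non_bipartite G S}"

subsection \<open>Polynomials and ideals\<close>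

type_synonym ('n, 'k) polyring = "(('n + 'n) \<Rightarrow>\<^sub>0 nat) \<Rightarrow>\<^sub>0 'k"

definition X :: "'n \<Rightarrow> ('n, 'k::comm_ring_1) polyring" where
  "X i = Poly_Mapping.single (Poly_Mapping.single (Inl i) 1) 1"

definition Y :: "'n \<Rightarrow> ('n, 'k::comm_ring_1) polyring" where
  "Y i = Poly_Mapping.single (Poly_Mapping.single (Inr i) 1) 1"

text \<open>The homogeneous part $R_d$; it contains \<open>0\<close>.\<close>

definition homogeneous_part :: "nat \<Rightarrow> ('n, 'k::comm_ring_1) polyring set" where
  "homogeneous_part d =
     {f. \<forall>m \<in> Poly_Mapping.keys f.
           (\<Sum>v \<in> Poly_Mapping.keys m. Poly_Mapping.lookup m v) = d}"

text \<open>An ideal of a commutative ring is a submodule of the ring acting on itself.\<close>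

definition ideal_gen :: "'a::comm_ring_1 set \<Rightarrow> 'a set" where
  "ideal_gen B = module.span (*) B"

lemma module_times: "module ((*) :: 'a::comm_ring_1 \<Rightarrow> 'a \<Rightarrow> 'a)"
  by unfold_locales (simp_all add: algebra_simps)

definition colon :: "'a::comm_ring_1 set \<Rightarrow> 'a \<Rightarrow> 'a set" where
  "colon I f = {g. g * f \<in> I}"

definition parity_binomial_edge_ideal ::
    "('n \<Rightarrow> 'n \<Rightarrow> bool) \<Rightarrow> ('n, 'k::comm_ring_1) polyring set" where
  "parity_binomial_edge_ideal G = ideal_gen {X i * X j - Y i * Y j | i j. G i j}"

definition p_plus :: "('n, 'k::comm_ring_1) polyring set" where
  "p_plus = ideal_gen {X i + Y i | i. True}"

text \<open>
  Meaningful when \<open>p\<close> is an associated prime of the graded ideal \<open>I\<close>, in which case a suitable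
  homogeneous \<open>f\<close> exists. Otherwise the value is \<open>Inf {} = 0\<close>; as \<open>gamma_n\<close> is positive,
  an equation \<open>v_number p I = gamma_n G\<close> entails that such an \<open>f\<close> exists.
\<close>

definition v_number ::
    "('n, 'k::comm_ring_1) polyring set \<Rightarrow> ('n, 'k) polyring set \<Rightarrow> nat" where
  "v_number p I = Inf {d. \<exists>f \<in> homogeneous_part d. colon I f = p}"

end

theory Submission
  imports Defs
begin

text \<open>
  Put \<open>a\<^sub>i = X i + Y i\<close> and \<open>b\<^sub>i = X i - Y i\<close>. As 2 is a unit, the ideal is generated by the
  permanents \<open>a\<^sub>i b\<^sub>j + a\<^sub>j b\<^sub>i\<close> over the edges.

  Upper bound: if \<open>S\<close> dominates and \<open>G[S]\<close> is totally non-bipartite, then \<open>f = \<Prod>i\<in>S. b\<^sub>i\<close> works.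
  Modulo the ideal, replacing one factor \<open>b\<^sub>v\<close> of \<open>f\<close> by \<open>a\<^sub>v\<close> gives a polynomial whose sign flips
  when \<open>v\<close> moves along an edge of \<open>G[S]\<close>, so an odd closed walk forces it to vanish.

  Lower bound: if the colon ideal of \<open>f\<close> is \<open>p_plus\<close>, then \<open>f\<close> is not in \<open>p_plus\<close>, because the
  product of all \<open>b\<^sub>i\<close> multiplies \<open>p_plus\<close> into the ideal. Take a monomial of \<open>f\<close> modulo \<open>p_plus\<close>
  and let \<open>S\<close> be its support. If \<open>S\<close> failed to dominate or had a bipartite component, the variety
  of the ideal would contain a family of points with \<open>b\<close> supported on \<open>S\<close> and \<open>a \<noteq> 0\<close>; there \<open>f\<close>
  vanishes, and letting \<open>a\<close> tend to 0 makes the coefficient of that monomial vanish.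
\<close>

section \<open>Monomial expansions and induction on polynomials\<close>

lemma poly_mapping_monomial_sum:
  fixes f :: "'a \<Rightarrow>\<^sub>0 'b::comm_monoid_add"
  assumes "finite A" "Poly_Mapping.keys f \<subseteq> A"
  shows "(\<Sum>k\<in>A. Poly_Mapping.single k (Poly_Mapping.lookup f k)) = f"
proof (rule poly_mapping_eqI)
  fix k
  have "(\<Sum>l\<in>A. Poly_Mapping.lookup (Poly_Mapping.single l (Poly_Mapping.lookup f l)) k)
      = (\<Sum>l\<in>A. if l = k then Poly_Mapping.lookup f k else 0)"
    by (intro sum.cong) (auto simp: lookup_single when_def)
  also have "\<dots> = Poly_Mapping.lookup f k"
    using assms by (auto simp: in_keys_iff)
  finally show "Poly_Mapping.lookup (\<Sum>l\<in>A. Poly_Mapping.single l (Poly_Mapping.lookup f l)) k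
      = Poly_Mapping.lookup f k"
    by (simp add: lookup_sum)
qed

lemma monomial_induct [case_names zero single add]:
  fixes f :: "'a \<Rightarrow>\<^sub>0 'b::comm_monoid_add"
  assumes zero: "P 0"
    and single: "\<And>k c. P (Poly_Mapping.single k c)"
    and add: "\<And>f g. P f \<Longrightarrow> P g \<Longrightarrow> P (f + g)"
  shows "P f"
proof -
  have "P (\<Sum>k\<in>A. Poly_Mapping.single k (Poly_Mapping.lookup f k))" if "finite A" for A
    using that by (induction A rule: finite_induct) (auto intro: assms)
  then show ?thesis
    by (metis poly_mapping_monomial_sum finite_keys order_refl)
qed

definition var :: "'v \<Rightarrow> ('v \<Rightarrow>\<^sub>0 nat) \<Rightarrow>\<^sub>0 'k::comm_ring_1" where
  "var v = Poly_Mapping.single (Poly_Mapping.single v 1) 1"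

lemma var_power: "var v ^ n = Poly_Mapping.single (Poly_Mapping.single v n) 1"
  by (induction n) (simp_all add: var_def mult_single flip: single_add)

lemma prod_single:
  "(\<Prod>v\<in>A. Poly_Mapping.single (g v) (c v :: 'k::comm_ring_1))
    = Poly_Mapping.single (\<Sum>v\<in>A. g v :: 'm::comm_monoid_add) (\<Prod>v\<in>A. c v)"
  by (induction A rule: infinite_finite_induct) (simp_all add: mult_single)

lemma single_conv_prod_var:
  fixes m :: "'v::finite \<Rightarrow>\<^sub>0 nat"
  shows "Poly_Mapping.single m c
    = Poly_Mapping.single 0 c * (\<Prod>v\<in>UNIV. var v ^ Poly_Mapping.lookup m v)"
  using poly_mapping_monomial_sum[of UNIV m]
  by (simp add: var_power prod_single mult_single)

text \<open>Constants and variables generate the polynomial ring as an algebra, since a monomial in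
  finitely many variables is a product of powers of variables.\<close>

lemma polynomial_induct [case_names const var add mult]:
  fixes f :: "('v::finite \<Rightarrow>\<^sub>0 nat) \<Rightarrow>\<^sub>0 'k::comm_ring_1"
  assumes const: "\<And>c. P (Poly_Mapping.single 0 c)"
    and var: "\<And>v. P (var v)"
    and add: "\<And>f g. P f \<Longrightarrow> P g \<Longrightarrow> P (f + g)"
    and mult: "\<And>f g. P f \<Longrightarrow> P g \<Longrightarrow> P (f * g)"
  shows "P f"
proof (induction f rule: monomial_induct)
  case zero
  then show ?case using const[of 0] by simp
next
  case (single m c)
  have one: "P 1" using const[of 1] by simp
  have power: "P (f ^ n)" if "P f" for f n
    using that one by (induction n) (auto intro: mult)
  have "P (\<Prod>v\<in>A. var v ^ Poly_Mapping.lookup m v)" for A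
    by (induction A rule: infinite_finite_induct) (auto intro: one mult power var)
  then show ?case
    unfolding single_conv_prod_var[of m c] by (intro mult const)
qed (rule add)

text \<open>Multiplication by a term shifts exponents injectively and scales every coefficient by
  \<open>c\<close>. The factors cancelled in the main argument are all of this kind.\<close>

lemma single_mult_eq_0D:
  fixes h :: "'m::cancel_comm_monoid_add \<Rightarrow>\<^sub>0 'k::idom"
  assumes "Poly_Mapping.single m c * h = 0" "c \<noteq> 0"
  shows "h = 0"
proof (rule poly_mapping_eqI)
  fix k
  have "Poly_Mapping.lookup (Poly_Mapping.single m c * h) (m + k) = c * Poly_Mapping.lookup h k"
  proof (induction h rule: monomial_induct)
    case (single l d)
    then show ?case by (simp add: mult_single lookup_single when_def)
  qed (simp_all add: lookup_add algebra_simps)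
  then show "Poly_Mapping.lookup h k = Poly_Mapping.lookup 0 k"
    using assms by simp
qed

section \<open>Substitution homomorphisms\<close>

definition subst ::
    "('v::finite \<Rightarrow> ('w \<Rightarrow>\<^sub>0 nat) \<Rightarrow>\<^sub>0 'k) \<Rightarrow> (('v \<Rightarrow>\<^sub>0 nat) \<Rightarrow>\<^sub>0 'k)
      \<Rightarrow> (('w \<Rightarrow>\<^sub>0 nat) \<Rightarrow>\<^sub>0 'k::comm_ring_1)" where
  "subst u f = (\<Sum>m\<in>Poly_Mapping.keys f. Poly_Mapping.single 0 (Poly_Mapping.lookup f m) *
     (\<Prod>v\<in>UNIV. u v ^ Poly_Mapping.lookup m v))"

text \<open>For additivity of \<open>subst\<close>: two polynomials and their sum can be expanded
  over one index set, even when terms of the sum cancel.\<close>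

lemma subst_superset:
  assumes "finite A" "Poly_Mapping.keys f \<subseteq> A"
  shows "subst u f = (\<Sum>m\<in>A. Poly_Mapping.single 0 (Poly_Mapping.lookup f m) *
     (\<Prod>v\<in>UNIV. u v ^ Poly_Mapping.lookup m v))"
  unfolding subst_def using assms
  by (intro sum.mono_neutral_left) (auto simp: in_keys_iff)

lemma subst_single:
  "subst u (Poly_Mapping.single m c)
    = Poly_Mapping.single 0 c * (\<Prod>v\<in>UNIV. u v ^ Poly_Mapping.lookup m v)"
  by (subst subst_superset[of "{m}"]) auto

lemma subst_0 [simp]: "subst u 0 = 0"
  by (simp add: subst_def)

lemma subst_add [simp]: "subst u (f + g) = subst u f + subst u g"
proof -
  let ?A = "Poly_Mapping.keys f \<union> Poly_Mapping.keys g"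
  have "Poly_Mapping.keys (f + g) \<subseteq> ?A" by (rule Poly_Mapping.keys_add)
  then show ?thesis
    by (simp add: subst_superset[of ?A] lookup_add single_add ring_distribs sum.distrib)
qed

lemma subst_mult [simp]:
  fixes u :: "'v::finite \<Rightarrow> ('w \<Rightarrow>\<^sub>0 nat) \<Rightarrow>\<^sub>0 'k::comm_ring_1"
  shows "subst u (f * g) = subst u f * subst u g"
proof (induction f rule: monomial_induct)
  case (single m c)
  show ?case
  proof (induction g rule: monomial_induct)
    case (single l d)
    have const_mult: "Poly_Mapping.single (0::'w \<Rightarrow>\<^sub>0 nat) (c * d)
        = Poly_Mapping.single 0 c * Poly_Mapping.single 0 d"
      by (simp add: mult_single)
    show ?case
      unfolding mult_single[of m c l d] subst_single lookup_add power_add prod.distrib const_mult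
      by (simp only: mult_ac)
  qed (simp_all add: ring_distribs)
qed (simp_all add: ring_distribs)

lemma subst_const [simp]: "subst u (Poly_Mapping.single 0 c) = Poly_Mapping.single 0 c"
  by (simp add: subst_single)

lemma subst_1 [simp]: "subst u 1 = 1"
  using subst_const[of u 1] by simp

lemma subst_diff [simp]: "subst u (f - g) = subst u f - subst u g"
  using subst_add[of u "f - g" g] by (simp add: algebra_simps)

lemma subst_uminus [simp]: "subst u (- f) = - subst u f"
  using subst_diff[of u 0 f] by simp

lemma subst_prod: "subst u (\<Prod>i\<in>A. g i) = (\<Prod>i\<in>A. subst u (g i))"
  by (induction A rule: infinite_finite_induct) simp_all

lemma subst_var [simp]: "subst u (var v) = u v"
proof -
  have "(\<Prod>w\<in>UNIV. u w ^ Poly_Mapping.lookup (Poly_Mapping.single v 1) w)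
      = (\<Prod>w\<in>UNIV. if w = v then u v else 1)"
    by (intro prod.cong) (auto simp: lookup_single when_def)
  then show ?thesis by (simp add: var_def subst_single)
qed

lemma subst_comp: "subst w (subst u f) = subst (\<lambda>v. subst w (u v)) f"
  by (induction f rule: polynomial_induct) simp_all

text \<open>Setting the variables outside \<open>T\<close> to zero kills each monomial that involves
  one of them and fixes all others.\<close>

lemma lookup_subst_restrict:
  assumes "Poly_Mapping.keys m \<subseteq> T"
  shows "Poly_Mapping.lookup (subst (\<lambda>v. if v \<in> T then var v else 0) h) m
    = Poly_Mapping.lookup h m"
proof (induction h rule: monomial_induct)
  case (single l c)
  show ?case
  proof (cases "Poly_Mapping.keys l \<subseteq> T")
    case True
    then have "Poly_Mapping.lookup l v = 0" if "v \<notin> T" for v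
      using that by (metis in_keys_iff subsetD)
    then have "(\<Prod>v\<in>UNIV. (if v \<in> T then var v else 0) ^ Poly_Mapping.lookup l v)
        = (\<Prod>v\<in>UNIV. (var v :: ('a \<Rightarrow>\<^sub>0 nat) \<Rightarrow>\<^sub>0 'b) ^ Poly_Mapping.lookup l v)"
      by (intro prod.cong) auto
    then show ?thesis by (simp add: subst_single flip: single_conv_prod_var)
  next
    case False
    then obtain v where "v \<in> Poly_Mapping.keys l" "v \<notin> T" by auto
    then have "(\<Prod>v\<in>UNIV. (if v \<in> T then (var v :: ('a \<Rightarrow>\<^sub>0 nat) \<Rightarrow>\<^sub>0 'b) else 0)
        ^ Poly_Mapping.lookup l v) = 0"
      by (intro prod_zero bexI[of _ v]) (auto simp: in_keys_iff zero_power)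
    moreover have "l \<noteq> m" using False assms by auto
    ultimately show ?thesis by (simp add: subst_single lookup_single when_def)
  qed
qed (simp_all add: lookup_add)

lemma X_conv_var: "X i = var (Inl i)" and Y_conv_var: "Y i = var (Inr i)"
  by (simp_all add: X_def Y_def var_def)

lemma subst_X [simp]: "subst u (X i) = u (Inl i)"
  and subst_Y [simp]: "subst u (Y i) = u (Inr i)"
  by (simp_all add: X_conv_var Y_conv_var)

section \<open>Homogeneous polynomials\<close>

lemma degree_conv_sum_UNIV:
  fixes m :: "'v::finite \<Rightarrow>\<^sub>0 nat"
  shows "(\<Sum>v\<in>Poly_Mapping.keys m. Poly_Mapping.lookup m v) = (\<Sum>v\<in>UNIV. Poly_Mapping.lookup m v)"
  by (intro sum.mono_neutral_left) (auto simp: in_keys_iff)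

lemma homogeneous_part_iff:
  "f \<in> homogeneous_part d \<longleftrightarrow>
    (\<forall>m\<in>Poly_Mapping.keys f. (\<Sum>v\<in>UNIV. Poly_Mapping.lookup m (v :: 'n::finite + 'n)) = d)"
  by (simp add: homogeneous_part_def degree_conv_sum_UNIV)

lemma homogeneous_part_mult:
  fixes f g :: "('n::finite, 'k::comm_ring_1) polyring"
  assumes "f \<in> homogeneous_part d" "g \<in> homogeneous_part e"
  shows "f * g \<in> homogeneous_part (d + e)"
  using assms Poly_Mapping.keys_mult[of f g]
  unfolding homogeneous_part_iff by (fastforce simp: lookup_add sum.distrib)

lemma homogeneous_part_add:
  fixes f g :: "('n::finite, 'k::comm_ring_1) polyring"
  assumes "f \<in> homogeneous_part d" "g \<in> homogeneous_part d"
  shows "f + g \<in> homogeneous_part d"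
  using assms Poly_Mapping.keys_add[of f g] unfolding homogeneous_part_iff by blast

lemma homogeneous_part_uminus:
  fixes f :: "('n::finite, 'k::comm_ring_1) polyring"
  shows "f \<in> homogeneous_part d \<Longrightarrow> - f \<in> homogeneous_part d"
  by (simp add: homogeneous_part_iff in_keys_iff)

lemma homogeneous_part_const:
  "(Poly_Mapping.single 0 c :: ('n::finite, 'k::comm_ring_1) polyring) \<in> homogeneous_part 0"
  by (simp add: homogeneous_part_iff)

lemma homogeneous_part_power:
  fixes f :: "('n::finite, 'k::comm_ring_1) polyring"
  assumes "f \<in> homogeneous_part d"
  shows "f ^ n \<in> homogeneous_part (n * d)"
  using homogeneous_part_const[of 1]
  by (induction n) (auto intro: homogeneous_part_mult assms)

lemma homogeneous_part_prod:
  fixes g :: "'i \<Rightarrow> ('n::finite, 'k::comm_ring_1) polyring"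
  assumes "\<And>i. i \<in> A \<Longrightarrow> g i \<in> homogeneous_part (d i)"
  shows "(\<Prod>i\<in>A. g i) \<in> homogeneous_part (\<Sum>i\<in>A. d i)"
  using assms homogeneous_part_const[of 1]
  by (induction A rule: infinite_finite_induct) (auto intro: homogeneous_part_mult)

lemma homogeneous_part_sum:
  fixes g :: "'i \<Rightarrow> ('n::finite, 'k::comm_ring_1) polyring"
  assumes "\<And>i. i \<in> A \<Longrightarrow> g i \<in> homogeneous_part d"
  shows "(\<Sum>i\<in>A. g i) \<in> homogeneous_part d"
  using assms
  by (induction A rule: infinite_finite_induct)
    (auto intro: homogeneous_part_add simp: homogeneous_part_iff[of 0])

lemma homogeneous_part_var:
  "(var v :: ('n::finite, 'k::comm_ring_1) polyring) \<in> homogeneous_part 1"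
proof -
  have "(\<Sum>w\<in>UNIV. Poly_Mapping.lookup (Poly_Mapping.single v (1::nat)) w) = 1"
    by (simp add: lookup_single when_def)
  then show ?thesis by (simp add: homogeneous_part_iff var_def)
qed

lemma homogeneous_part_subst:
  fixes f :: "('n::finite, 'k::comm_ring_1) polyring"
    and u :: "'n + 'n \<Rightarrow> ('m::finite, 'k) polyring"
  assumes f: "f \<in> homogeneous_part d" and u: "\<And>v. u v \<in> homogeneous_part 1"
  shows "subst u f \<in> homogeneous_part d"
  unfolding subst_def
proof (rule homogeneous_part_sum)
  fix m assume m: "m \<in> Poly_Mapping.keys f"
  have "(\<Prod>v\<in>UNIV. u v ^ Poly_Mapping.lookup m v)
      \<in> homogeneous_part (\<Sum>v\<in>UNIV. Poly_Mapping.lookup m v * 1)"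
    by (intro homogeneous_part_prod homogeneous_part_power u)
  also have "(\<Sum>v\<in>UNIV. Poly_Mapping.lookup m v * 1) = d"
    using f m by (simp add: homogeneous_part_iff)
  finally show "Poly_Mapping.single 0 (Poly_Mapping.lookup f m) *
      (\<Prod>v\<in>UNIV. u v ^ Poly_Mapping.lookup m v) \<in> homogeneous_part d"
    using homogeneous_part_mult[OF homogeneous_part_const] by fastforce
qed

section \<open>Generated ideals and the quotient by \<open>p_plus\<close>\<close>

lemma ideal_gen_base: "x \<in> B \<Longrightarrow> x \<in> ideal_gen B"
  unfolding ideal_gen_def by (rule module.span_base[OF module_times])

lemma ideal_gen_add: "x \<in> ideal_gen B \<Longrightarrow> y \<in> ideal_gen B \<Longrightarrow> x + y \<in> ideal_gen B"
  unfolding ideal_gen_def by (rule module.span_add[OF module_times])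

lemma ideal_gen_diff: "x \<in> ideal_gen B \<Longrightarrow> y \<in> ideal_gen B \<Longrightarrow> x - y \<in> ideal_gen B"
  unfolding ideal_gen_def by (rule module.span_diff[OF module_times])

lemma ideal_gen_0: "0 \<in> ideal_gen B"
  unfolding ideal_gen_def by (rule module.span_zero[OF module_times])

lemma ideal_gen_mult: "y \<in> ideal_gen B \<Longrightarrow> x * y \<in> ideal_gen B"
  unfolding ideal_gen_def by (rule module.span_scale[OF module_times])

lemma ideal_gen_induct [consumes 1, case_names zero add]:
  assumes "x \<in> ideal_gen B" "P 0"
    and "\<And>c b y. b \<in> B \<Longrightarrow> P y \<Longrightarrow> P (c * b + y)"
  shows "P x"
  using assms unfolding ideal_gen_def by (rule module.span_induct_alt[OF module_times])

lemma subst_ideal_gen_eq_0: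
  assumes "x \<in> ideal_gen B" "\<And>b. b \<in> B \<Longrightarrow> subst u b = 0"
  shows "subst u x = 0"
  using assms(1) by (induction x rule: ideal_gen_induct) (simp_all add: assms(2))

text \<open>The quotient map modulo \<open>p_plus\<close>, realised as an endomorphism whose image
  lies in the polynomials in the \<open>X i\<close> alone.\<close>

definition to_p_plus :: "('n, 'k::comm_ring_1) polyring \<Rightarrow> ('n::finite, 'k) polyring" where
  "to_p_plus = subst (case_sum X (\<lambda>i. - X i))"

text \<open>The generators map to 0; conversely, every polynomial is congruent to its image modulo
  \<open>p_plus\<close>, so it lies in \<open>p_plus\<close> once the image vanishes.\<close>

lemma p_plus_iff: "g \<in> p_plus \<longleftrightarrow> to_p_plus g = 0"
proof
  assume "g \<in> p_plus"
  then show "to_p_plus g = 0"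
    unfolding p_plus_def to_p_plus_def by (rule subst_ideal_gen_eq_0) auto
next
  have "g - to_p_plus g \<in> p_plus"
  proof (induction g rule: polynomial_induct)
    case (const c)
    then show ?case by (simp add: to_p_plus_def p_plus_def ideal_gen_0)
  next
    case (var v)
    show ?case
    proof (cases v)
      case (Inl i)
      then show ?thesis by (simp add: to_p_plus_def p_plus_def ideal_gen_0 X_conv_var)
    next
      case (Inr i)
      then have "var v - to_p_plus (var v) = X i + Y i"
        by (simp add: to_p_plus_def Y_conv_var)
      then show ?thesis unfolding p_plus_def by (auto intro!: ideal_gen_base)
    qed
  next
    case (add f g)
    then have "(f - to_p_plus f) + (g - to_p_plus g) \<in> p_plus"
      unfolding p_plus_def by (rule ideal_gen_add)
    then show ?case by (simp add: to_p_plus_def algebra_simps)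
  next
    case (mult f g)
    \<comment> \<open>This sum telescopes to
      \<open>f * g - to_p_plus f * to_p_plus g\<close>.\<close>
    then have "g * (f - to_p_plus f) + to_p_plus f * (g - to_p_plus g) \<in> p_plus"
      unfolding p_plus_def by (intro ideal_gen_add ideal_gen_mult)
    then show ?case by (simp add: to_p_plus_def algebra_simps)
  qed
  then show "to_p_plus g = 0 \<Longrightarrow> g \<in> p_plus" by simp
qed

lemma parity_ideal_subset_p_plus:
  "parity_binomial_edge_ideal G \<subseteq> (p_plus :: ('n::finite, 'k::comm_ring_1) polyring set)"
proof
  fix x :: "('n, 'k) polyring"
  assume "x \<in> parity_binomial_edge_ideal G"
  then show "x \<in> p_plus"
    unfolding parity_binomial_edge_ideal_def p_plus_iff to_p_plus_def
    by (rule subst_ideal_gen_eq_0) auto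
qed

section \<open>Upper bound: products of the forms \<open>X i - Y i\<close>\<close>

lemma double_single:
  "2 * Poly_Mapping.single (m :: 'm::comm_monoid_add) (c::'k::comm_ring_1)
    = Poly_Mapping.single m (2 * c)"
  by (simp only: mult_2 single_add)

lemma half_double:
  fixes x :: "('n, 'k::field) polyring"
  assumes "(2::'k) \<noteq> 0"
  shows "Poly_Mapping.single 0 (1 / 2) * (2 * x) = x"
proof -
  have "Poly_Mapping.single (0 :: 'n + 'n \<Rightarrow>\<^sub>0 nat) (1 / 2 :: 'k) * 2 = Poly_Mapping.single 0 1"
    using assms by (simp add: mult_single flip: single_numeral)
  then show ?thesis by (simp flip: mult.assoc)
qed

lemma ideal_gen_half:
  fixes x :: "('n, 'k::field) polyring"
  assumes "(2::'k) \<noteq> 0" "2 * x \<in> ideal_gen B"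
  shows "x \<in> ideal_gen B"
  using ideal_gen_mult[OF assms(2), of "Poly_Mapping.single 0 (1 / 2)"]
  by (simp add: half_double assms(1))

text \<open>The mixed terms cancel, leaving twice the generator of the edge.\<close>

lemma edge_permanent_mem:
  assumes "G i j"
  shows "(X i + Y i) * (X j - Y j) + (X j + Y j) * (X i - Y i)
    \<in> (parity_binomial_edge_ideal G :: ('n, 'k::comm_ring_1) polyring set)"
proof -
  have "2 * (X i * X j - Y i * Y j) \<in> (parity_binomial_edge_ideal G :: ('n, 'k) polyring set)"
    unfolding parity_binomial_edge_ideal_def using assms
    by (intro ideal_gen_mult ideal_gen_base) auto
  then show ?thesis by (simp add: algebra_simps)
qed

definition replaced_prod :: "'n::finite set \<Rightarrow> 'n \<Rightarrow> ('n, 'k::comm_ring_1) polyring" where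
  "replaced_prod S v = (X v + Y v) * (\<Prod>i\<in>S - {v}. X i - Y i)"

text \<open>The two products share all factors indexed by \<open>S - {u} - {v}\<close>; what remains
  of the sum is the permanent of the edge.\<close>

lemma replaced_prod_edge:
  fixes G :: "'n::finite \<Rightarrow> 'n \<Rightarrow> bool"
  assumes "u \<in> S" "v \<in> S" "G u v" "u \<noteq> v"
  shows "replaced_prod S u + replaced_prod S v
    \<in> (parity_binomial_edge_ideal G :: ('n, 'k::comm_ring_1) polyring set)"
proof -
  let ?b = "\<lambda>i. X i - Y i :: ('n, 'k) polyring"
  let ?r = "\<Prod>i\<in>S - {u} - {v}. ?b i"
  have expand: "(\<Prod>i\<in>S - {u}. ?b i) = ?b v * ?r" "(\<Prod>i\<in>S - {v}. ?b i) = ?b u * ?r"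
    using assms prod.remove[of "S - {u}" v ?b] prod.remove[of "S - {v}" u ?b]
    by (auto simp: Diff_insert2[symmetric] insert_commute simp flip: Diff_insert)
  have "replaced_prod S u + replaced_prod S v
      = ?r * ((X u + Y u) * ?b v + (X v + Y v) * ?b u)"
    unfolding replaced_prod_def expand by (simp add: algebra_simps)
  also have "\<dots> \<in> parity_binomial_edge_ideal G"
    using edge_permanent_mem[of G u v, OF assms(3)] unfolding parity_binomial_edge_ideal_def
    by (rule ideal_gen_mult)
  finally show ?thesis .
qed

text \<open>
  The sign of \<open>replaced_prod S v\<close> modulo the ideal flips along each edge, so outside the ideal
  it would two-colour the component of \<open>v\<close>.
\<close>

lemma replaced_prod_mem:
  fixes G :: "'n::finite \<Rightarrow> 'n \<Rightarrow> bool"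
  assumes two: "(2::'k::field) \<noteq> 0" and G: "simple_graph G"
    and S: "totally_non_bipartite G S" and v: "v \<in> S"
  shows "replaced_prod S v \<in> (parity_binomial_edge_ideal G :: ('n, 'k) polyring set)"
proof (rule ccontr)
  let ?I = "parity_binomial_edge_ideal G :: ('n, 'k) polyring set"
  let ?P = "replaced_prod S :: 'n \<Rightarrow> ('n, 'k) polyring"
  assume notin: "?P v \<notin> ?I"
  define C where "C = {w. (induced G S)\<^sup>*\<^sup>* v w}"
  have add: "x + y \<in> ?I" and diff: "x - y \<in> ?I" if "x \<in> ?I" "y \<in> ?I" for x y
    using that ideal_gen_add ideal_gen_diff unfolding parity_binomial_edge_ideal_def by blast+
  have edge: "?P u + ?P w \<in> ?I" if "induced G S u w" for u w
    using that G by (intro replaced_prod_edge) (auto simp: induced_def simple_graph_def irreflp_def)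
  have alt: "?P w - ?P v \<in> ?I \<or> ?P w + ?P v \<in> ?I" if "(induced G S)\<^sup>*\<^sup>* v w" for w
    using that
  proof (induction rule: rtranclp_induct)
    case base
    then show ?case by (simp add: parity_binomial_edge_ideal_def ideal_gen_0)
  next
    case (step u w)
    then show ?case
      using diff[OF edge[of u w], of "?P u - ?P v"] diff[OF edge[of u w], of "?P u + ?P v"]
      by (auto simp: algebra_simps)
  qed
  have C_sub: "C \<subseteq> S"
  proof
    fix w assume "w \<in> C"
    then have "(induced G S)\<^sup>*\<^sup>* v w" by (simp add: C_def)
    then show "w \<in> S" by (induction rule: rtranclp_induct) (auto simp: induced_def v)
  qed
  \<comment> \<open>One colour class consists of the \<open>u\<close> for which \<open>?P u\<close>
    is congruent to \<open>?P v\<close>. Two adjacent vertices in it would put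
    \<open>2 * ?P v\<close> into the ideal; if one end of an edge is outside, \<open>alt\<close>
    makes its product congruent to \<open>- ?P v\<close>, which forces the other end inside.\<close>
  have "bipartite (induced G C)"
    unfolding bipartite_def
  proof (intro exI allI impI)
    fix u w assume uw: "induced G C u w"
    then have e: "?P u + ?P w \<in> ?I" using C_sub by (intro edge) (auto simp: induced_def)
    have "\<not> (?P u - ?P v \<in> ?I \<and> ?P w - ?P v \<in> ?I)"
    proof
      assume "?P u - ?P v \<in> ?I \<and> ?P w - ?P v \<in> ?I"
      then have "(?P u + ?P w) - ((?P u - ?P v) + (?P w - ?P v)) \<in> ?I"
        by (intro diff[OF e] add[of "?P u - ?P v" "?P w - ?P v"]) auto
      also have "(?P u + ?P w) - ((?P u - ?P v) + (?P w - ?P v)) = 2 * ?P v" by simp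
      finally show False
        using notin ideal_gen_half[OF two] unfolding parity_binomial_edge_ideal_def by blast
    qed
    moreover have "?P u - ?P v \<in> ?I \<or> ?P w - ?P v \<in> ?I"
    proof (rule disjCI)
      assume "?P w - ?P v \<notin> ?I"
      then have "?P w + ?P v \<in> ?I" using alt[of w] uw by (auto simp: induced_def C_def)
      then show "?P u - ?P v \<in> ?I" using diff[OF e] by fastforce
    qed
    ultimately show "u \<in> {u. ?P u - ?P v \<in> ?I} \<longleftrightarrow> w \<notin> {u. ?P u - ?P v \<in> ?I}" by blast
  qed
  moreover have "C \<in> induced_components G S"
    using v by (auto simp: induced_components_def C_def)
  ultimately show False using S by (simp add: totally_non_bipartite_def)
qed

text \<open>It suffices to treat the generators \<open>X v + Y v\<close>. For \<open>v\<close> in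
  \<open>S\<close>, the product with \<open>?f\<close> is a multiple of
  \<open>replaced_prod S v\<close>. Otherwise \<open>v\<close> has a neighbour \<open>u\<close> in
  \<open>S\<close>, and the permanent of this edge trades the product for a multiple of
  \<open>replaced_prod S u\<close>.\<close>

lemma p_plus_times_prod_mem:
  fixes G :: "'n::finite \<Rightarrow> 'n \<Rightarrow> bool"
  assumes two: "(2::'k::field) \<noteq> 0" and G: "simple_graph G"
    and S: "totally_non_bipartite G S" and dom: "dominating G S"
    and g: "g \<in> p_plus"
  shows "g * (\<Prod>i\<in>S. X i - Y i) \<in> (parity_binomial_edge_ideal G :: ('n, 'k) polyring set)"
proof -
  let ?I = "parity_binomial_edge_ideal G :: ('n, 'k) polyring set"
  let ?f = "\<Prod>i\<in>S. X i - Y i :: ('n, 'k) polyring"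
  have mult: "c * x \<in> ?I" and diff: "x - y \<in> ?I" if "x \<in> ?I" "y \<in> ?I" for c x y
    using that ideal_gen_mult ideal_gen_diff unfolding parity_binomial_edge_ideal_def by blast+
  have split: "?f = (X u - Y u) * (\<Prod>i\<in>S - {u}. X i - Y i)" if "u \<in> S" for u
    using that by (simp add: prod.remove)
  have gen: "(X v + Y v) * ?f \<in> ?I" for v
  proof (cases "v \<in> S")
    case True
    have "(X v - Y v) * replaced_prod S v \<in> ?I"
      using replaced_prod_mem[OF two G S True] mult by blast
    then show ?thesis by (simp add: split[OF True] replaced_prod_def mult_ac)
  next
    case False
    then obtain u where u: "u \<in> S" "G v u" using dom by (auto simp: dominating_def)
    let ?r = "\<Prod>i\<in>S - {u}. X i - Y i :: ('n, 'k) polyring"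
    have "?r * ((X v + Y v) * (X u - Y u) + (X u + Y u) * (X v - Y v))
        - (X v - Y v) * replaced_prod S u \<in> ?I"
      using edge_permanent_mem[of G v u, OF u(2)] replaced_prod_mem[OF two G S u(1)]
      by (intro diff mult) blast+
    also have "?r * ((X v + Y v) * (X u - Y u) + (X u + Y u) * (X v - Y v))
        - (X v - Y v) * replaced_prod S u = (X v + Y v) * ?f"
      by (simp add: split[OF u(1)] replaced_prod_def algebra_simps)
    finally show ?thesis .
  qed
  show ?thesis
    using g unfolding p_plus_def
  proof (induction g rule: ideal_gen_induct)
    case zero
    then show ?case by (simp add: parity_binomial_edge_ideal_def ideal_gen_0)
  next
    case (add c b y)
    then obtain v where "b = X v + Y v" by auto
    then have "c * (b * ?f) \<in> ?I" using gen mult by blast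
    then show ?case
      using add.IH ideal_gen_add unfolding parity_binomial_edge_ideal_def
      by (simp add: ring_distribs mult.assoc)
  qed
qed

lemma to_p_plus_prod:
  "to_p_plus (\<Prod>i\<in>S. X i - Y i :: ('n::finite, 'k::comm_ring_1) polyring)
    = Poly_Mapping.single (\<Sum>i\<in>S. Poly_Mapping.single (Inl i) 1) (2 ^ card S)"
proof -
  have factor: "to_p_plus (X i - Y i :: ('n, 'k) polyring)
      = Poly_Mapping.single (Poly_Mapping.single (Inl i) 1) 2" for i
  proof -
    have "to_p_plus (X i - Y i :: ('n, 'k) polyring) = 2 * X i" by (simp add: to_p_plus_def)
    then show ?thesis by (simp add: X_def double_single)
  qed
  have "to_p_plus (\<Prod>i\<in>S. X i - Y i :: ('n, 'k) polyring) = (\<Prod>i\<in>S. to_p_plus (X i - Y i))"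
    unfolding to_p_plus_def by (rule subst_prod)
  then show ?thesis
    by (simp add: factor prod_single)
qed

text \<open>For the inclusion into \<open>p_plus\<close>: each factor \<open>X i - Y i\<close>
  becomes \<open>2 * X i\<close> in the quotient, so the whole product becomes a nonzero term and
  can be cancelled.\<close>

lemma colon_prod_eq_p_plus:
  fixes G :: "'n::finite \<Rightarrow> 'n \<Rightarrow> bool"
  assumes two: "(2::'k::field) \<noteq> 0" and G: "simple_graph G"
    and S: "totally_non_bipartite G S" and dom: "dominating G S"
  shows "colon (parity_binomial_edge_ideal G) (\<Prod>i\<in>S. X i - Y i)
    = (p_plus :: ('n, 'k) polyring set)"
proof
  show "p_plus \<subseteq> colon (parity_binomial_edge_ideal G) (\<Prod>i\<in>S. X i - Y i :: ('n, 'k) polyring)"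
    using p_plus_times_prod_mem[OF assms] by (auto simp: colon_def)
  show "colon (parity_binomial_edge_ideal G) (\<Prod>i\<in>S. X i - Y i) \<subseteq> (p_plus :: ('n, 'k) polyring set)"
  proof
    fix g :: "('n, 'k) polyring"
    assume "g \<in> colon (parity_binomial_edge_ideal G) (\<Prod>i\<in>S. X i - Y i)"
    then have "to_p_plus ((\<Prod>i\<in>S. X i - Y i) * g) = 0"
      using parity_ideal_subset_p_plus[of G] p_plus_iff by (auto simp: colon_def mult.commute)
    then have "to_p_plus (\<Prod>i\<in>S. X i - Y i) * to_p_plus g = 0"
      by (simp add: to_p_plus_def)
    then have "to_p_plus g = 0"
      unfolding to_p_plus_prod by (rule single_mult_eq_0D) (simp add: two)
    then show "g \<in> p_plus" by (simp add: p_plus_iff)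
  qed
qed

section \<open>Lower bound: supports of monomials modulo \<open>p_plus\<close>\<close>

lemma UNIV_totally_non_bipartite:
  assumes "connected_graph G" "\<not> bipartite G"
  shows "totally_non_bipartite G UNIV"
proof -
  have "induced G UNIV = G" by (simp add: induced_def fun_eq_iff)
  then show ?thesis
    using assms by (auto simp: totally_non_bipartite_def induced_components_def connected_graph_def)
qed

lemma not_mem_p_plus_if_colon_eq:
  fixes G :: "'n::finite \<Rightarrow> 'n \<Rightarrow> bool"
  assumes two: "(2::'k::field) \<noteq> 0" and G: "simple_graph G" "connected_graph G" "\<not> bipartite G"
    and f: "colon (parity_binomial_edge_ideal G) f = (p_plus :: ('n, 'k) polyring set)"
  shows "f \<notin> p_plus"
proof
  let ?B = "\<Prod>i\<in>UNIV. X i - Y i :: ('n, 'k) polyring"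
  assume "f \<in> p_plus"
  then have "f * ?B \<in> parity_binomial_edge_ideal G"
    using UNIV_totally_non_bipartite G
    by (intro p_plus_times_prod_mem two) (auto simp: dominating_def)
  \<comment> \<open>Membership of \<open>f * ?B\<close> in the ideal says that \<open>?B\<close>
    lies in the colon ideal of \<open>f\<close>; but the image of \<open>?B\<close> modulo
    \<open>p_plus\<close> is a nonzero term.\<close>
  then have "?B \<in> p_plus" unfolding f[symmetric] by (simp add: colon_def mult.commute)
  then have "to_p_plus ?B * 1 = 0" by (simp add: p_plus_iff)
  then have "(1 :: ('n, 'k) polyring) = 0"
    unfolding to_p_plus_prod by (rule single_mult_eq_0D) (simp add: two)
  then show False by simp
qed

text \<open>
  Evaluation along the curve \<open>b\<^sub>i = 2 X i\<close> on \<open>S\<close>, \<open>b\<^sub>i = 0\<close> off \<open>S\<close>, \<open>a\<^sub>i = 2 \<alpha>\<^sub>i\<close>,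
  specialised to \<open>a = 0\<close> afterwards.
\<close>

lemma to_p_plus_coeff_eq_0:
  fixes G :: "'n::finite \<Rightarrow> 'n \<Rightarrow> bool" and f :: "('n, 'k::field) polyring"
    and \<alpha> :: "'n \<Rightarrow> ('n, 'k) polyring" and S :: "'n set"
  defines "\<beta> \<equiv> \<lambda>i. if i \<in> S then X i else 0"
  assumes edge: "\<And>i j. G i j \<Longrightarrow> \<alpha> i * \<beta> j + \<alpha> j * \<beta> i = 0"
    and y0: "\<And>i. subst (case_sum X (\<lambda>_. 0)) (\<alpha> i) = 0"
    and v: "2 * \<alpha> v = Poly_Mapping.single l c" "c \<noteq> 0"
    and f: "p_plus \<subseteq> colon (parity_binomial_edge_ideal G) f"
    and m: "Poly_Mapping.keys m \<subseteq> Inl ` S"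
  shows "Poly_Mapping.lookup (to_p_plus f) m = 0"
proof -
  define \<phi> where "\<phi> = subst (case_sum (\<lambda>i. \<alpha> i + \<beta> i) (\<lambda>i. \<alpha> i - \<beta> i))"
  have "X v + Y v \<in> (p_plus :: ('n, 'k) polyring set)"
    unfolding p_plus_def by (intro ideal_gen_base) auto
  then have "(X v + Y v) * f \<in> parity_binomial_edge_ideal G"
    using f by (auto simp: colon_def)
  then have "\<phi> ((X v + Y v) * f) = 0"
    unfolding parity_binomial_edge_ideal_def \<phi>_def
  proof (rule subst_ideal_gen_eq_0)
    fix b assume "b \<in> {X i * X j - Y i * Y j :: ('n, 'k) polyring | i j. G i j}"
    then obtain i j where b: "b = X i * X j - Y i * Y j" and ij: "G i j" by blast
    \<comment> \<open>Here \<open>X i\<close> goes to \<alpha> i + \<beta> i and \<open>Y i\<close>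
      to \<alpha> i - \<beta> i, so the edge binomial becomes twice the permanent of \<alpha> and
      \<beta>.\<close>
    have "subst (case_sum (\<lambda>i. \<alpha> i + \<beta> i) (\<lambda>i. \<alpha> i - \<beta> i)) b = 2 * (\<alpha> i * \<beta> j + \<alpha> j * \<beta> i)"
      by (simp add: b algebra_simps)
    then show "subst (case_sum (\<lambda>i. \<alpha> i + \<beta> i) (\<lambda>i. \<alpha> i - \<beta> i)) b = 0"
      by (simp only: edge[OF ij] mult_zero_right)
  qed
  moreover have "\<phi> ((X v + Y v) * f) = (2 * \<alpha> v) * \<phi> f" by (simp add: \<phi>_def)
  ultimately have "(2 * \<alpha> v) * \<phi> f = 0" by simp
  \<comment> \<open>The image of \<open>X v + Y v\<close> is the nonzero term
    \<open>2 * \<alpha> v\<close>, which cancels.\<close>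
  then have "\<phi> f = 0" unfolding v(1) by (rule single_mult_eq_0D) (rule v(2))
  then have "subst (case_sum X (\<lambda>_. 0)) (\<phi> f) = 0" by simp
  \<comment> \<open>Killing the \<open>Y\<close> variables removes \<alpha>, so \<open>X i\<close>
    and \<open>Y i\<close> become \<beta> i and -\<beta> i: this is \<open>to_p_plus\<close>
    followed by setting \<open>X i\<close> to 0 off \<open>S\<close>.\<close>
  moreover have "subst (case_sum X (\<lambda>_. 0)) (\<phi> f)
      = subst (\<lambda>w. if w \<in> Inl ` S then var w else 0) (to_p_plus f)"
    unfolding \<phi>_def to_p_plus_def subst_comp
    by (rule arg_cong[where f = "\<lambda>u. subst u f"])
      (auto simp: fun_eq_iff y0 \<beta>_def X_conv_var split: sum.splits)
  ultimately show ?thesis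
    using lookup_subst_restrict[OF m, of "to_p_plus f"] by simp
qed

text \<open>At an undominated vertex \<open>v\<close>, take \<alpha> to be the free parameter
  \<open>Y v\<close> at \<open>v\<close> and 0 elsewhere. Every edge equation holds because \<beta>
  vanishes at all neighbours of \<open>v\<close>.\<close>

lemma support_dominating:
  fixes G :: "'n::finite \<Rightarrow> 'n \<Rightarrow> bool" and f :: "('n, 'k::field) polyring"
  assumes two: "(2::'k) \<noteq> 0" and G: "simple_graph G"
    and f: "p_plus \<subseteq> colon (parity_binomial_edge_ideal G) f"
    and m: "Poly_Mapping.lookup (to_p_plus f) m \<noteq> 0" "Poly_Mapping.keys m \<subseteq> Inl ` S"
  shows "dominating G S"
proof (rule ccontr)
  assume "\<not> dominating G S"
  then obtain v where v: "v \<notin> S" "\<And>u. u \<in> S \<Longrightarrow> \<not> G v u" by (auto simp: dominating_def)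
  then have v': "\<And>u. u \<in> S \<Longrightarrow> \<not> G u v" using G by (auto simp: simple_graph_def dest: sympD)
  have "2 * Y v = Poly_Mapping.single (Poly_Mapping.single (Inr v) 1) (2::'k)"
    by (simp add: Y_def double_single)
  then have "Poly_Mapping.lookup (to_p_plus f) m = 0"
    using v v' two
    by (intro to_p_plus_coeff_eq_0[where \<alpha> = "\<lambda>i. if i = v then Y v else 0" and v = v, OF _ _ _ _ f m(2)])
      auto
  with m(1) show False by contradiction
qed

text \<open>On a bipartite component \<open>C\<close> of the induced graph on \<open>S\<close>, a
  two-colouring gives signs \<open>s i\<close>. Then \<alpha> i = \<open>s i * (Y v * X i)\<close>
  solves the edge equations: opposite signs cancel inside \<open>C\<close>, no edge joins
  \<open>C\<close> to the rest of \<open>S\<close>, and \<alpha> and \<beta> both vanish off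
  \<open>S\<close>. The factor \<open>Y v\<close> is the parameter that tends to 0.\<close>

lemma support_totally_non_bipartite:
  fixes G :: "'n::finite \<Rightarrow> 'n \<Rightarrow> bool" and f :: "('n, 'k::field) polyring"
  assumes two: "(2::'k) \<noteq> 0" and G: "simple_graph G"
    and f: "p_plus \<subseteq> colon (parity_binomial_edge_ideal G) f"
    and m: "Poly_Mapping.lookup (to_p_plus f) m \<noteq> 0" "Poly_Mapping.keys m \<subseteq> Inl ` S"
  shows "totally_non_bipartite G S"
proof (rule ccontr)
  assume "\<not> totally_non_bipartite G S"
  then obtain v A where v: "v \<in> S"
    and A: "\<And>u w. induced G {w. (induced G S)\<^sup>*\<^sup>* v w} u w \<Longrightarrow> u \<in> A \<longleftrightarrow> w \<notin> A"
    by (auto simp: totally_non_bipartite_def induced_components_def bipartite_def)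
  define C where "C = {w. (induced G S)\<^sup>*\<^sup>* v w}"
  define s where "s i = (if i \<in> C then if i \<in> A then 1 else - 1 else 0 :: ('n, 'k) polyring)" for i
  have C_step: "w \<in> C" if "u \<in> C" "u \<in> S" "w \<in> S" "G u w" for u w
    using that by (auto simp: C_def induced_def intro: rtranclp.rtrancl_into_rtrancl)
  have C_sub: "w \<in> S" if "w \<in> C" for w
  proof -
    have "(induced G S)\<^sup>*\<^sup>* v w" using that by (simp add: C_def)
    then show ?thesis by (induction rule: rtranclp_induct) (auto simp: induced_def v)
  qed
  have s_edge: "s i + s j = 0" if "G i j" "i \<in> S" "j \<in> S" for i j
  proof (cases "i \<in> C")
    case True
    then have "j \<in> C" using C_step that by blast
    then show ?thesis using A[of i j] True that by (auto simp: s_def C_def induced_def)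
  next
    case False
    then have "j \<notin> C"
      using C_step[of j i] that G by (auto simp: simple_graph_def dest: sympD)
    then show ?thesis using False by (simp add: s_def)
  qed
  have s_off: "s i = 0" if "i \<notin> S" for i using that C_sub by (auto simp: s_def)
  have "v \<in> C" by (simp add: C_def)
  \<comment> \<open>At the base vertex \<open>v\<close> of \<open>C\<close> the sign is nonzero, so
    \<alpha> v supplies the term to be cancelled.\<close>
  have "2 * (s v * Y v * X v) = Poly_Mapping.single
      (Poly_Mapping.single (Inr v) 1 + Poly_Mapping.single (Inl v) 1) (if v \<in> A then 2 else - 2 :: 'k)"
    using \<open>v \<in> C\<close> by (simp add: s_def Y_def X_def mult_single double_single single_uminus)
  then have "2 * (s v * (Y v * X v)) = Poly_Mapping.single
      (Poly_Mapping.single (Inr v) 1 + Poly_Mapping.single (Inl v) 1) (if v \<in> A then 2 else - 2 :: 'k)"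
    by (simp only: mult.assoc)
  moreover have "s i * (Y v * X i) * (if j \<in> S then X j else 0)
      + s j * (Y v * X j) * (if i \<in> S then X i else 0) = 0" if "G i j" for i j
  proof (cases "i \<in> S \<and> j \<in> S")
    case True
    then have "s i * (Y v * X i) * (if j \<in> S then X j else 0)
      + s j * (Y v * X j) * (if i \<in> S then X i else 0) = (s i + s j) * (Y v * X i * X j)"
      by (simp add: algebra_simps)
    then show ?thesis using s_edge that True by simp
  next
    case False
    then show ?thesis by (auto simp: s_off)
  qed
  ultimately have "Poly_Mapping.lookup (to_p_plus f) m = 0"
    using two
    by (intro to_p_plus_coeff_eq_0[where \<alpha> = "\<lambda>i. s i * (Y v * X i)" and v = v
          and c = "if v \<in> A then 2 else - 2", OF _ _ _ _ f m(2)])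
      (auto split: if_splits)
  with m(1) show False by contradiction
qed

section \<open>Degree count and the equality\<close>

lemma card_support_le_degree:
  fixes m :: "'n::finite + 'n \<Rightarrow>\<^sub>0 nat"
  shows "card {i. Inl i \<in> Poly_Mapping.keys m} \<le> (\<Sum>v\<in>UNIV. Poly_Mapping.lookup m v)"
proof -
  have "card {i. Inl i \<in> Poly_Mapping.keys m}
      = card (Inl ` {i. Inl i \<in> Poly_Mapping.keys m} :: ('n + 'n) set)"
    by (simp add: card_image)
  also have "\<dots> \<le> card (Poly_Mapping.keys m)" by (intro card_mono) auto
  also have "\<dots> = (\<Sum>v\<in>Poly_Mapping.keys m. 1)" by simp
  also have "\<dots> \<le> (\<Sum>v\<in>Poly_Mapping.keys m. Poly_Mapping.lookup m v)"
    by (intro sum_mono) (simp add: in_keys_iff Suc_le_eq)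
  finally show ?thesis by (simp add: degree_conv_sum_UNIV)
qed

text \<open>Since \<open>Y i\<close> is replaced by \<open>- X i\<close>, only \<open>Inl\<close>
  variables survive, so the indices of these variables capture the full support of
  \<open>m\<close>.\<close>

lemma keys_to_p_plus:
  fixes f :: "('n::finite, 'k::comm_ring_1) polyring"
  assumes "m \<in> Poly_Mapping.keys (to_p_plus f)"
  shows "Poly_Mapping.keys m \<subseteq> Inl ` {i. Inl i \<in> Poly_Mapping.keys m}"
proof
  fix w assume w: "w \<in> Poly_Mapping.keys m"
  have "w \<in> range Inl" if "m \<in> Poly_Mapping.keys (to_p_plus f)" "w \<in> Poly_Mapping.keys m"
    for m w
    using that
  proof (induction f arbitrary: m w rule: polynomial_induct)
    case (const c)
    then show ?case by (auto simp: to_p_plus_def split: if_splits)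
  next
    case (var v)
    then show ?case by (cases v) (auto simp: to_p_plus_def X_def split: if_splits)
  next
    case (add f g)
    then show ?case
      using Poly_Mapping.keys_add[of "to_p_plus f" "to_p_plus g"] by (auto simp: to_p_plus_def)
  next
    case (mult f g)
    then obtain k l where "m = k + l" "k \<in> Poly_Mapping.keys (to_p_plus f)"
      "l \<in> Poly_Mapping.keys (to_p_plus g)"
      using Poly_Mapping.keys_mult[of "to_p_plus f" "to_p_plus g"] by (auto simp: to_p_plus_def)
    then show ?case using mult Poly_Mapping.keys_add[of k l] by blast
  qed
  from this[OF assms w] w show "w \<in> Inl ` {i. Inl i \<in> Poly_Mapping.keys m}" by auto
qed

text \<open>The map \<open>to_p_plus\<close> substitutes linear forms and so preserves degree. A
  monomial of the nonzero image of \<open>f\<close> has degree \<open>d\<close>, hence at most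
  \<open>d\<close> distinct variables, and their indices form the required set.\<close>

lemma exists_set_card_le:
  fixes G :: "'n::finite \<Rightarrow> 'n \<Rightarrow> bool"
  assumes two: "(2::'k::field) \<noteq> 0" and G: "simple_graph G" "connected_graph G" "\<not> bipartite G"
    and f: "colon (parity_binomial_edge_ideal G) f = (p_plus :: ('n, 'k) polyring set)"
    and d: "f \<in> homogeneous_part d"
  shows "\<exists>S. dominating G S \<and> totally_non_bipartite G S \<and> card S \<le> d"
proof -
  have "to_p_plus f \<noteq> 0" using not_mem_p_plus_if_colon_eq[OF two G f] by (simp add: p_plus_iff)
  then obtain m where m: "m \<in> Poly_Mapping.keys (to_p_plus f)" by fastforce
  define S where "S = {i. Inl i \<in> Poly_Mapping.keys m}"
  have "to_p_plus f \<in> homogeneous_part d"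
    unfolding to_p_plus_def using d
    by (rule homogeneous_part_subst)
      (auto simp: X_conv_var split: sum.splits
        intro!: homogeneous_part_uminus homogeneous_part_var[unfolded One_nat_def])
  then have "card S \<le> d"
    using m card_support_le_degree[of m] by (auto simp: homogeneous_part_iff S_def)
  moreover have "Poly_Mapping.lookup (to_p_plus f) m \<noteq> 0" using m by (simp add: in_keys_iff)
  moreover have "Poly_Mapping.keys m \<subseteq> Inl ` S" unfolding S_def by (rule keys_to_p_plus[OF m])
  moreover have "p_plus \<subseteq> colon (parity_binomial_edge_ideal G) f" using f by simp
  ultimately show ?thesis
    using support_dominating[OF two G(1)] support_totally_non_bipartite[OF two G(1)] by blast
qed

lemma prod_homogeneous:
  "(\<Prod>i\<in>S. X i - Y i :: ('n::finite, 'k::comm_ring_1) polyring) \<in> homogeneous_part (card S)"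
proof -
  have "X i - Y i \<in> (homogeneous_part 1 :: ('n, 'k) polyring set)" for i
    using homogeneous_part_add[OF homogeneous_part_var homogeneous_part_uminus[OF homogeneous_part_var]]
    by (simp add: X_conv_var Y_conv_var)
  then show ?thesis using homogeneous_part_prod[of S "\<lambda>i. X i - Y i :: ('n, 'k) polyring" "\<lambda>_. 1"] by simp
qed

theorem theorem7p5:
  fixes G :: "'n::finite \<Rightarrow> 'n \<Rightarrow> bool"
  assumes "CHAR('k::alg_closed_field) \<noteq> 2"
    and "simple_graph G"
    and "connected_graph G"
    and "\<not> bipartite G"
  shows "v_number (p_plus :: ('n, 'k) polyring set) (parity_binomial_edge_ideal G) = gamma_n G"
proof -
  \<comment> \<open>If 2 vanished, the characteristic would divide the prime 2, but it is neither 1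
    nor 2.\<close>
  have two: "(2::'k) \<noteq> 0"
  proof
    assume "(2::'k) = 0"
    then have "CHAR('k) dvd 2" using of_nat_eq_0_iff_char_dvd[of 2, where 'a = 'k] by simp
    then show False
      using assms(1) CHAR_not_1'[where 'a = 'k] two_is_prime_nat by (auto simp: prime_nat_iff)
  qed
  let ?N = "{card S | S. dominating G S \<and> totally_non_bipartite G S}"
  have "?N \<noteq> {}"
    using UNIV_totally_non_bipartite[OF assms(3,4)] by (auto simp: dominating_def)
  then have "Min ?N \<in> ?N" by (intro Min_in) auto
  then obtain S where S: "gamma_n G = card S" "dominating G S" "totally_non_bipartite G S"
    by (auto simp: gamma_n_def)
  \<comment> \<open>The value \<open>gamma_n G\<close> is attained by the product over an optimal
    \<open>S\<close>, so the infimum is a genuine minimum and not the default value of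
    \<open>Inf {}\<close>.\<close>
  show ?thesis
    unfolding v_number_def
  proof (rule cInf_eq_minimum)
    show "gamma_n G \<in> {d. \<exists>f\<in>homogeneous_part d.
        colon (parity_binomial_edge_ideal G) f = (p_plus :: ('n, 'k) polyring set)}"
      using colon_prod_eq_p_plus[OF two assms(2) S(3,2)] prod_homogeneous S(1) by auto
  next
    fix d
    assume "d \<in> {d. \<exists>f\<in>homogeneous_part d.
        colon (parity_binomial_edge_ideal G) f = (p_plus :: ('n, 'k) polyring set)}"
    then obtain T where T: "dominating G T" "totally_non_bipartite G T" "card T \<le> d"
      using exists_set_card_le[OF two assms(2-4)] by blast
    then have "gamma_n G \<le> card T" unfolding gamma_n_def by (intro Min_le) auto
    with T(3) show "gamma_n G \<le> d" by simp
  qed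
qed

end
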